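(* Let $T$ be a non-trivial tree (a finite tree with at least two vertices). Then $\chi_{\rm pcf}(T)=2$ if $T=K_2$, and $\chi_{\rm pcf}(T)=3$ otherwise.
   Context: All graphs are simple, finite and undirected. A vertex coloring of a graph is proper if adjacent vertices get distinct colors. It is conflict-free (with respect to open neighborhoods) if for every non-isolated vertex $x$ there is a color that appears exactly once on the open neighborhood $N(x)$. A PCF $k$-coloring is a vertex coloring with at most $k$ colors that is both proper and conflict-free. The PCF chromatic number $\chi_{\rm pcf}(G)$ is the minimum $k$ for which $G$ admits a PCF $k$-coloring. *)

theory Defs
  imports "Graph_Theory.Graph_Theory"
begin

text \<open>
  A finite simple undirected graph is a symmetric digraph, \<^locale>\<open>graph\<close>. In this encoding the
  library's \<^const>\<open>tree\<close> does not describe undirected trees: its \<^const>\<open>forest\<close> counts the closed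
  walk u, v, u along an edge and its reverse as a cycle. The cycles of the underlying undirected
  graph are those of length at least 3.
\<close>

definition undirected_tree :: "('a, 'b) pre_digraph \<Rightarrow> bool" where
  "undirected_tree G \<longleftrightarrow>
     graph G \<and> connected G \<and> \<not> (\<exists>p. pre_digraph.cycle G p \<and> 3 \<le> length p)"

definition open_nbhd :: "('a, 'b) pre_digraph \<Rightarrow> 'a \<Rightarrow> 'a set" where
  "open_nbhd G x = {y. x \<rightarrow>\<^bsub>G\<^esub> y}"

definition proper_coloring :: "('a, 'b) pre_digraph \<Rightarrow> ('a \<Rightarrow> nat) \<Rightarrow> bool" where
  "proper_coloring G c \<longleftrightarrow> (\<forall>u v. u \<rightarrow>\<^bsub>G\<^esub> v \<longrightarrow> c u \<noteq> c v)"

definition conflict_free_coloring :: "('a, 'b) pre_digraph \<Rightarrow> ('a \<Rightarrow> nat) \<Rightarrow> bool" where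
  "conflict_free_coloring G c \<longleftrightarrow>
     (\<forall>x \<in> verts G. open_nbhd G x \<noteq> {} \<longrightarrow> (\<exists>a. \<exists>!y. y \<in> open_nbhd G x \<and> c y = a))"

definition pcf_coloring :: "('a, 'b) pre_digraph \<Rightarrow> nat \<Rightarrow> ('a \<Rightarrow> nat) \<Rightarrow> bool" where
  "pcf_coloring G k c \<longleftrightarrow>
     card (c ` verts G) \<le> k \<and> proper_coloring G c \<and> conflict_free_coloring G c"

definition chi_pcf :: "('a, 'b) pre_digraph \<Rightarrow> nat" where
  "chi_pcf G = (LEAST k. \<exists>c. pcf_coloring G k c)"

text \<open>The minimum is attained, since an injective coloring is always a PCF coloring.\<close>

lemma pcf_coloring_exists:
  assumes "graph G"
  shows "\<exists>c. pcf_coloring G (card (verts G)) c"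
proof -
  interpret graph G by fact
  obtain c :: "'a \<Rightarrow> nat" where c: "inj_on c (verts G)"
    using finite_imp_inj_to_nat_seg[OF finite_verts] by blast
  have nb: "v \<in> verts G" if "u \<rightarrow>\<^bsub>G\<^esub> v" for u v
    using that by (rule adj_in_verts)
  have "proper_coloring G c"
    unfolding proper_coloring_def
    using c by (metis adj_in_verts adj_not_same inj_onD)
  moreover have "conflict_free_coloring G c"
    unfolding conflict_free_coloring_def
  proof (intro ballI impI)
    fix x assume "open_nbhd G x \<noteq> {}"
    then obtain y where "y \<in> open_nbhd G x" by blast
    then have "\<exists>!z. z \<in> open_nbhd G x \<and> c z = c y"
      using c nb unfolding open_nbhd_def inj_on_def by blast
    then show "\<exists>a. \<exists>!z. z \<in> open_nbhd G x \<and> c z = a" by blast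
  qed
  ultimately show ?thesis
    unfolding pcf_coloring_def using card_image[OF c] by (metis order_refl)
qed

end

theory Submission
  imports Defs
begin

text \<open>
  A tree is built from a single vertex by attaching leaves. A leaf attached at s gets, out of three
  colors, one that differs from the color of s and from a color occurring exactly once around s, so
  a PCF 3-coloring extends. Conversely, in a proper 2-coloring all neighbors of a vertex share a
  color, so no vertex may have two neighbors, which leaves only K_2.
\<close>

section \<open>Growing a connected vertex set one vertex at a time\<close>

context wf_digraph
begin

text \<open>Symmetry makes a connected graph strongly connected, so each vertex is reachable from
  \<open>s\<close> and membership in \<open>S\<close> propagates along the walk. It is mostly
  applied contrapositively: a nonempty set of vertices other than \<open>verts G\<close> has an arc
  leaving it.\<close>

lemma connected_closed_set_eq_verts:
  assumes "symmetric G" "connected G"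
    and "s \<in> S" "S \<subseteq> verts G"
    and closed: "\<And>x y. x \<in> S \<Longrightarrow> x \<rightarrow>\<^bsub>G\<^esub> y \<Longrightarrow> y \<in> S"
  shows "S = verts G"
proof -
  have "v \<in> S" if "v \<in> verts G" for v
  proof -
    have "s \<rightarrow>\<^sup>*\<^bsub>G\<^esub> v"
      using symmetric_connected_imp_strongly_connected[OF assms(1,2)] assms(3,4) that
      by (blast elim: strongly_connectedE)
    then show ?thesis
      using \<open>s \<in> S\<close> closed by (induct rule: reachable_induct) auto
  qed
  with \<open>S \<subseteq> verts G\<close> show ?thesis by blast
qed

lemma dominates_induce_iff:
  assumes "S \<subseteq> verts G"
  shows "x \<rightarrow>\<^bsub>G \<restriction> S\<^esub> y \<longleftrightarrow> x \<in> S \<and> y \<in> S \<and> x \<rightarrow>\<^bsub>G\<^esub> y"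
  using assms by (auto simp: arcs_ends_conv induce_subgraph_def)

end

text \<open>As long as \<open>S\<close> misses a vertex, some arc leaves it, and the head of that
  arc is the next vertex to add. Finiteness makes the process end at \<open>verts G\<close>.\<close>

lemma (in fin_digraph) connected_grow_induct [consumes 3, case_names base step]:
  assumes "symmetric G" "connected G" "r \<in> verts G"
    and base: "P {r}"
    and step: "\<And>S s y. \<lbrakk>S \<subseteq> verts G; r \<in> S; P S; s \<in> S; y \<in> verts G - S; s \<rightarrow>\<^bsub>G\<^esub> y\<rbrakk>
      \<Longrightarrow> P (insert y S)"
  shows "P (verts G)"
proof -
  \<comment> \<open>Starting from an arbitrary \<open>S\<close> instead of \<open>{r}\<close> allows
    induction on the number of vertices still missing.\<close>
  have "P (verts G)" if "S \<subseteq> verts G" "r \<in> S" "P S" for S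
    using that
  proof (induct "card (verts G - S)" arbitrary: S rule: less_induct)
    case less
    show ?case
    proof (cases "S = verts G")
      case False
      then obtain s y where sy: "s \<in> S" "s \<rightarrow>\<^bsub>G\<^esub> y" "y \<notin> S"
        using connected_closed_set_eq_verts[OF assms(1,2) \<open>r \<in> S\<close> \<open>S \<subseteq> verts G\<close>] by blast
      then have y: "y \<in> verts G - S" by (auto dest: adj_in_verts)
      have "card (verts G - insert y S) < card (verts G - S)"
        using y by (intro psubset_card_mono) auto
      then show ?thesis
        using less.hyps[of "insert y S"] less.prems step[OF less.prems sy(1) y sy(2)] y by blast
    qed (use less.prems in simp)
  qed
  from this[of "{r}"] assms(3) base show ?thesis by simp
qed

section \<open>Paths inside a vertex set and uniqueness of the attachment vertex\<close>

text \<open>The paths are paths of \<open>G\<close> confined to \<open>S\<close>, so they avoid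
  every vertex outside \<open>S\<close>; this lets such a vertex close a path into a cycle.\<close>

definition (in pre_digraph) apath_connected_in :: "'a set \<Rightarrow> bool" where
  "apath_connected_in S \<longleftrightarrow>
     (\<forall>u\<in>S. \<forall>v\<in>S. \<exists>p. apath u p v \<and> set (awalk_verts u p) \<subseteq> S)"

context wf_digraph
begin

lemma awalk_snoc:
  assumes "awalk u p s" "e \<in> arcs G" "tail G e = s" "head G e = y"
  shows "awalk u (p @ [e]) y"
  using assms arc_implies_awalk[of e] by (auto intro: awalk_appendI simp del: awalk_append_iff)

lemma awalk_verts_snoc:
  assumes "awalk u p s" "e \<in> arcs G" "tail G e = s" "head G e = y"
  shows "awalk_verts u (p @ [e]) = awalk_verts u p @ [y]"
  using awalk_verts_append[OF awalk_snoc[OF assms]] assms by simp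

end

context graph
begin

text \<open>Paths through \<open>s\<close> are prolonged by the arc into \<open>y\<close>, or
  preceded by the reverse arc out of \<open>y\<close>. Vertices stay distinct because the old path
  lies in \<open>S\<close> and \<open>y\<close> does not.\<close>

lemma apath_connected_in_insert:
  assumes S: "apath_connected_in S" and "s \<in> S" "s \<rightarrow>\<^bsub>G\<^esub> y" "y \<notin> S"
  shows "apath_connected_in (insert y S)"
proof -
  obtain e where e: "e \<in> arcs G" "tail G e = s" "head G e = y"
    using \<open>s \<rightarrow>\<^bsub>G\<^esub> y\<close> by blast
  have "y \<rightarrow>\<^bsub>G\<^esub> s" using \<open>s \<rightarrow>\<^bsub>G\<^esub> y\<close> by (rule graph_symmetric)
  then obtain f where f: "f \<in> arcs G" "tail G f = y" "head G f = s" by blast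
  have to_y: "\<exists>p. apath u p y \<and> set (awalk_verts u p) \<subseteq> insert y S" if u: "u \<in> S" for u
  proof -
    obtain p where p: "apath u p s" "set (awalk_verts u p) \<subseteq> S"
      using S u \<open>s \<in> S\<close> unfolding apath_connected_in_def by blast
    have "awalk u p s" using p(1) by (simp add: apath_def)
    note walk = awalk_snoc[OF this e] and verts = awalk_verts_snoc[OF this e]
    have "distinct (awalk_verts u (p @ [e]))"
      unfolding verts using p \<open>y \<notin> S\<close> by (auto simp: apath_def)
    with walk have "apath u (p @ [e]) y" by (simp add: apath_def del: awalk_append_iff)
    moreover have "set (awalk_verts u (p @ [e])) \<subseteq> insert y S"
      unfolding verts using p(2) by auto
    ultimately show ?thesis by blast
  qed
  have from_y: "\<exists>p. apath y p v \<and> set (awalk_verts y p) \<subseteq> insert y S" if v: "v \<in> S" for v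
  proof -
    obtain p where p: "apath s p v" "set (awalk_verts s p) \<subseteq> S"
      using S v \<open>s \<in> S\<close> unfolding apath_connected_in_def by blast
    have "apath y (f # p) v" using f p \<open>y \<notin> S\<close> by (auto simp: apath_Cons_iff)
    moreover have "set (awalk_verts y (f # p)) \<subseteq> insert y S"
      using f p(2) by (simp add: subset_insertI2)
    ultimately show ?thesis by blast
  qed
  have "apath y [] y" using e head_in_verts[of e] by (simp add: apath_Nil_iff)
  then have "\<exists>p. apath y p y \<and> set (awalk_verts y p) \<subseteq> insert y S"
    by (intro exI[of _ "[]"]) simp
  moreover have "\<exists>p. apath u p v \<and> set (awalk_verts u p) \<subseteq> insert y S" if "u \<in> S" "v \<in> S" for u v
    using S that unfolding apath_connected_in_def by (meson subset_insertI2)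
  ultimately show ?thesis
    using to_y from_y unfolding apath_connected_in_def by simp
qed

text \<open>Two different neighbors of \<open>y\<close> in \<open>S\<close> would be joined by a
  path in \<open>S\<close>, and going from \<open>y\<close> along this path and back to
  \<open>y\<close> would be a cycle.\<close>

lemma unique_neighbor_in_apath_connected_set:
  assumes acyclic: "\<not> (\<exists>p. cycle p \<and> 3 \<le> length p)"
    and S: "apath_connected_in S" "y \<notin> S"
    and "s \<in> S" "s \<rightarrow>\<^bsub>G\<^esub> y" "t \<in> S" "t \<rightarrow>\<^bsub>G\<^esub> y"
  shows "s = t"
proof (rule ccontr)
  assume "s \<noteq> t"
  obtain e where e: "e \<in> arcs G" "tail G e = t" "head G e = y"
    using \<open>t \<rightarrow>\<^bsub>G\<^esub> y\<close> by blast
  have "y \<rightarrow>\<^bsub>G\<^esub> s" using \<open>s \<rightarrow>\<^bsub>G\<^esub> y\<close> by (rule graph_symmetric)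
  then obtain f where f: "f \<in> arcs G" "tail G f = y" "head G f = s" by blast
  obtain p where p: "apath s p t" "set (awalk_verts s p) \<subseteq> S"
    using assms unfolding apath_connected_in_def by blast
  \<comment> \<open>A nonempty \<open>p\<close> gives the closed walk at least three arcs, so it is
    not merely an edge followed by its reverse.\<close>
  have "p \<noteq> []" using p(1) \<open>s \<noteq> t\<close> by (auto simp: apath_Nil_iff)
  have "awalk s p t" using p(1) by (simp add: apath_def)
  note walk = awalk_snoc[OF this e] and verts = awalk_verts_snoc[OF this e]
  have "awalk y (f # p @ [e]) y"
    using walk f by (simp add: awalk_Cons_iff del: awalk_append_iff)
  moreover have "distinct (tl (awalk_verts y (f # p @ [e])))"
    using verts f p \<open>y \<notin> S\<close> by (auto simp: apath_def)
  ultimately have "cycle (f # p @ [e])"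
    unfolding cycle_def by blast
  moreover have "3 \<le> length (f # p @ [e])"
    using \<open>p \<noteq> []\<close> by (cases p) auto
  ultimately show False using acyclic by blast
qed

section \<open>Three colors suffice\<close>

text \<open>Only the neighborhoods of \<open>s\<close> and \<open>y\<close> change, so only these
  two vertices can spoil the coloring. The fixed palette \<open>{..<3}\<close> guarantees a color
  that avoids two given ones.\<close>

lemma pcf_coloring_extend_leaf:
  fixes c :: "'a \<Rightarrow> nat"
  assumes S: "S \<subseteq> verts G" "s \<in> S" "y \<in> verts G - S" "s \<rightarrow>\<^bsub>G\<^esub> y"
    and leaf: "\<And>t. t \<in> S \<Longrightarrow> t \<rightarrow>\<^bsub>G\<^esub> y \<Longrightarrow> t = s"
    and c: "c ` S \<subseteq> {..<3}" "proper_coloring (G \<restriction> S) c" "conflict_free_coloring (G \<restriction> S) c"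
  shows "\<exists>d. d ` insert y S \<subseteq> {..<3} \<and> proper_coloring (G \<restriction> insert y S) d \<and>
    conflict_free_coloring (G \<restriction> insert y S) d"
proof -
  let ?S' = "insert y S"
  have S': "?S' \<subseteq> verts G" using S by blast
  note adj = dominates_induce_iff[OF S(1)] dominates_induce_iff[OF S']
  have "y \<rightarrow>\<^bsub>G\<^esub> s" using S(4) by (rule graph_symmetric)
  have leaf': "t = s" if "t \<in> S" "y \<rightarrow>\<^bsub>G\<^esub> t" for t
    using leaf that graph_symmetric by blast
  have no_loop: "\<not> y \<rightarrow>\<^bsub>G\<^esub> y" using adj_not_same by blast
  \<comment> \<open>If \<open>s\<close> is isolated in the old subgraph, \<open>a\<close> is
    arbitrary; avoiding it then does no harm.\<close>
  obtain a where a: "open_nbhd (G \<restriction> S) s \<noteq> {} \<Longrightarrow>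
      \<exists>!z. z \<in> open_nbhd (G \<restriction> S) s \<and> c z = a"
    using c(3) \<open>s \<in> S\<close> unfolding conflict_free_coloring_def by (metis induce_subgraph_verts)
  have "card {c s, a} < card {..<3::nat}"
    using card_insert_le_m1[of 2 "{a}" "c s"] by simp
  then obtain b where b: "b < 3" "b \<noteq> c s" "b \<noteq> a"
    by (metis card_mono finite.emptyI finite.insertI insert_iff leD lessThan_iff subsetI)
  define d where "d = c(y := b)"
  have d: "d y = b" "\<And>x. x \<in> S \<Longrightarrow> d x = c x"
    using S(3) by (auto simp: d_def)
  have "d ` ?S' \<subseteq> {..<3}" using d b(1) c(1) by auto
  moreover have "proper_coloring (G \<restriction> ?S') d"
    unfolding proper_coloring_def
  proof (intro allI impI)
    fix u v assume "u \<rightarrow>\<^bsub>G \<restriction> ?S'\<^esub> v"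
    then have uv: "u \<in> ?S'" "v \<in> ?S'" "u \<rightarrow>\<^bsub>G\<^esub> v" by (auto simp: adj)
    consider "u \<in> S" "v \<in> S" | "u = y" "v = s" | "u = s" "v = y"
      using uv leaf leaf' no_loop by blast
    then show "d u \<noteq> d v"
    proof cases
      case 1
      then show ?thesis using c(2) uv d(2) by (auto simp: proper_coloring_def adj)
    qed (use b d \<open>s \<in> S\<close> in auto)
  qed
  moreover have "\<exists>a. \<exists>!z. z \<in> open_nbhd (G \<restriction> ?S') x \<and> d z = a"
    if x: "x \<in> ?S'" and ne: "open_nbhd (G \<restriction> ?S') x \<noteq> {}" for x
  proof -
    consider "x = y" | "x = s" "x \<noteq> y" | "x \<in> S" "x \<noteq> s" using x S(3) by blast
    then show ?thesis
    proof cases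
      case 1
      have "open_nbhd (G \<restriction> ?S') y = {s}"
        unfolding open_nbhd_def adj using leaf' no_loop \<open>y \<rightarrow>\<^bsub>G\<^esub> s\<close> \<open>s \<in> S\<close> by blast
      then show ?thesis using 1 by auto
    next
      case 2
      have N: "open_nbhd (G \<restriction> ?S') s = insert y (open_nbhd (G \<restriction> S) s)"
        using S by (auto simp: open_nbhd_def adj)
      have sub: "open_nbhd (G \<restriction> S) s \<subseteq> S" by (auto simp: open_nbhd_def adj)
      show ?thesis
      proof (cases "open_nbhd (G \<restriction> S) s = {}")
        case True
        then show ?thesis using 2 N by auto
      next
        case False
        \<comment> \<open>The new neighbor \<open>y\<close> has color \<open>b\<close>, different
          from \<open>a\<close>, so the color class of \<open>a\<close> around \<open>s\<close> is
          unchanged.\<close>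
        have "z \<in> open_nbhd (G \<restriction> ?S') s \<and> d z = a \<longleftrightarrow> z \<in> open_nbhd (G \<restriction> S) s \<and> c z = a" for z
          using N sub d b(3) S(3) by auto
        with a[OF False] have "\<exists>!z. z \<in> open_nbhd (G \<restriction> ?S') s \<and> d z = a" by simp
        with 2 show ?thesis by blast
      qed
    next
      case 3
      \<comment> \<open>A vertex of \<open>S\<close> other than \<open>s\<close> is not adjacent to
        the leaf \<open>y\<close>.\<close>
      have N: "open_nbhd (G \<restriction> ?S') x = open_nbhd (G \<restriction> S) x"
        unfolding open_nbhd_def adj using 3 S(3) leaf by blast
      have "z \<in> open_nbhd (G \<restriction> S) x \<Longrightarrow> d z = c z" for z
        using d by (auto simp: open_nbhd_def adj)
      moreover obtain a' where "\<exists>!z. z \<in> open_nbhd (G \<restriction> S) x \<and> c z = a'"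
        using c(3) 3 ne N unfolding conflict_free_coloring_def by (metis induce_subgraph_verts)
      ultimately show ?thesis using N by metis
    qed
  qed
  then have "conflict_free_coloring (G \<restriction> ?S') d"
    by (simp add: conflict_free_coloring_def)
  ultimately show ?thesis by blast
qed

end

lemma undirected_tree_pcf_3_coloring:
  assumes "undirected_tree G" "verts G \<noteq> {}"
  shows "\<exists>c. pcf_coloring G 3 c"
proof -
  interpret graph G using assms unfolding undirected_tree_def by blast
  have conn: "connected G" and acyclic: "\<not> (\<exists>p. cycle p \<and> 3 \<le> length p)"
    using assms unfolding undirected_tree_def by auto
  obtain r where r: "r \<in> verts G" using assms(2) by blast
  \<comment> \<open>Path-connectedness is carried along with the coloring: together with acyclicity
    it shows that each added vertex is a leaf.\<close>
  have "apath_connected_in (verts G) \<and> (\<exists>c::'a \<Rightarrow> nat. c ` verts G \<subseteq> {..<3} \<and>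
    proper_coloring (G \<restriction> verts G) c \<and> conflict_free_coloring (G \<restriction> verts G) c)"
    using sym_arcs conn r
  proof (induct rule: connected_grow_induct)
    case base
    have "apath r [] r" using r by (simp add: apath_Nil_iff)
    then have "apath_connected_in {r}"
      unfolding apath_connected_in_def by (auto intro!: exI[of _ "[]"])
    moreover have "\<not> x \<rightarrow>\<^bsub>G \<restriction> {r}\<^esub> y" for x y
      using dominates_induce_iff[of "{r}" x y] r adj_not_same by auto
    ultimately show ?case
      by (auto simp: proper_coloring_def conflict_free_coloring_def open_nbhd_def
        intro!: exI[of _ "\<lambda>_. 0"])
  next
    case (step S s y)
    have "t = s" if "t \<in> S" "t \<rightarrow>\<^bsub>G\<^esub> y" for t
      using unique_neighbor_in_apath_connected_set[OF acyclic, of S y t s] step that by blast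
    with step show ?case
      using apath_connected_in_insert[of S s y] pcf_coloring_extend_leaf[of S s y] by blast
  qed
  then obtain c :: "'a \<Rightarrow> nat" where c: "c ` verts G \<subseteq> {..<3}"
      "proper_coloring (G \<restriction> verts G) c" "conflict_free_coloring (G \<restriction> verts G) c"
    by blast
  \<comment> \<open>The coloring conditions depend only on vertices and adjacency, so they pass from
    the full induced subgraph to \<open>G\<close>.\<close>
  have "x \<rightarrow>\<^bsub>G \<restriction> verts G\<^esub> y \<longleftrightarrow> x \<rightarrow>\<^bsub>G\<^esub> y" for x y
    using dominates_induce_iff[of "verts G" x y] adj_in_verts by auto
  moreover have "card (c ` verts G) \<le> 3"
    using card_mono[OF _ c(1)] by simp
  ultimately show ?thesis
    using c unfolding pcf_coloring_def
    by (auto simp: proper_coloring_def conflict_free_coloring_def open_nbhd_def)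
qed

section \<open>Lower bounds and the exact value\<close>

lemma (in graph) connected_exists_edge:
  assumes "connected G" "2 \<le> card (verts G)"
  obtains u v where "u \<rightarrow>\<^bsub>G\<^esub> v"
proof -
  obtain u where u: "u \<in> verts G" using assms(2) by fastforce
  have "{u} \<noteq> verts G"
  proof
    assume "{u} = verts G"
    from assms(2)[folded this] show False by simp
  qed
  then show ?thesis
    using that connected_closed_set_eq_verts[OF sym_arcs assms(1), of u "{u}"] u by blast
qed

text \<open>If no vertex had two neighbors, the ends of any edge would form a set closed under
  adjacency, hence the whole vertex set, and the graph would be K_2.\<close>

lemma (in graph) connected_exists_two_neighbors:
  assumes "connected G" "2 \<le> card (verts G)" "\<not> K\<^bsub>2\<^esub> G"
  obtains x y z where "x \<rightarrow>\<^bsub>G\<^esub> y" "x \<rightarrow>\<^bsub>G\<^esub> z" "y \<noteq> z"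
proof -
  obtain u v where uv: "u \<rightarrow>\<^bsub>G\<^esub> v" using connected_exists_edge assms(1,2) by blast
  then have vu: "v \<rightarrow>\<^bsub>G\<^esub> u" by (rule graph_symmetric)
  have "u \<noteq> v" using uv adj_not_same by blast
  have False if unique: "\<And>x y z. x \<rightarrow>\<^bsub>G\<^esub> y \<Longrightarrow> x \<rightarrow>\<^bsub>G\<^esub> z \<Longrightarrow> y = z"
  proof -
    have V: "{u, v} = verts G"
      using connected_closed_set_eq_verts[OF sym_arcs assms(1), of u "{u, v}"]
        adj_in_verts[OF uv] unique uv vu by blast
    then have "card (verts G) = 2" using \<open>u \<noteq> v\<close> by (metis card_2_iff)
    moreover have "arcs_ends G = {(x, y). (x, y) \<in> verts G \<times> verts G \<and> x \<noteq> y}"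
    proof (rule set_eqI)
      fix a :: "'a \<times> 'a"
      obtain x y where a: "a = (x, y)" by force
      have "x \<rightarrow>\<^bsub>G\<^esub> y \<longleftrightarrow> x \<in> {u, v} \<and> y \<in> {u, v} \<and> x \<noteq> y"
        unfolding V using uv vu adj_in_verts adj_not_same V by (metis insert_iff singletonD)
      then show "a \<in> arcs_ends G \<longleftrightarrow> a \<in> {(x, y). (x, y) \<in> verts G \<times> verts G \<and> x \<noteq> y}"
        using V a by simp
    qed
    ultimately show False
      using assms(3) graph_axioms unfolding complete_digraph_def by blast
  qed
  then show ?thesis using that by blast
qed

lemma (in graph) pcf_coloring_edge_ge_2:
  assumes "u \<rightarrow>\<^bsub>G\<^esub> v" "pcf_coloring G k c"
  shows "2 \<le> k"
proof -
  have "c u \<noteq> c v" using assms unfolding pcf_coloring_def proper_coloring_def by blast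
  then have "2 = card (c ` {u, v})" by simp
  also have "\<dots> \<le> card (c ` verts G)"
    using adj_in_verts[OF assms(1)] by (intro card_mono) auto
  finally show ?thesis using assms(2) unfolding pcf_coloring_def by simp
qed

text \<open>Were all neighbors of \<open>x\<close> colored alike, their color would occur at least
  twice and no color exactly once. So two colors occur around \<open>x\<close>, and properness makes
  the color of \<open>x\<close> a third.\<close>

lemma (in graph) pcf_coloring_two_neighbors_ge_3:
  assumes xy: "x \<rightarrow>\<^bsub>G\<^esub> y" and xz: "x \<rightarrow>\<^bsub>G\<^esub> z" and "y \<noteq> z" "pcf_coloring G k c"
  shows "3 \<le> k"
proof -
  have k: "card (c ` verts G) \<le> k" and proper: "\<And>w. x \<rightarrow>\<^bsub>G\<^esub> w \<Longrightarrow> c x \<noteq> c w"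
    and cf: "conflict_free_coloring G c"
    using assms(4) unfolding pcf_coloring_def proper_coloring_def by auto
  have "open_nbhd G x \<noteq> {}" using xy by (auto simp: open_nbhd_def)
  then obtain a where a: "\<exists>!w. w \<in> open_nbhd G x \<and> c w = a"
    using cf adj_in_verts[OF xy] unfolding conflict_free_coloring_def by blast
  \<comment> \<open>One choice is the neighbor whose color \<open>a\<close> is unique, together with
    one of \<open>y\<close> and \<open>z\<close> different from it.\<close>
  obtain p q where pq: "x \<rightarrow>\<^bsub>G\<^esub> p" "x \<rightarrow>\<^bsub>G\<^esub> q" "c p \<noteq> c q"
    using a xy xz \<open>y \<noteq> z\<close> unfolding open_nbhd_def by (metis mem_Collect_eq)
  have "3 = card (c ` {x, p, q})" using proper[OF pq(1)] proper[OF pq(2)] pq(3) by simp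
  also have "\<dots> \<le> card (c ` verts G)"
    using adj_in_verts[OF pq(1)] adj_in_verts[OF pq(2)] by (intro card_mono) auto
  finally show ?thesis using k by simp
qed

theorem mainTheorem1:
  fixes T :: "('a, 'b) pre_digraph"
  assumes "undirected_tree T"
    and "2 \<le> card (verts T)"
  shows "(K\<^bsub>2\<^esub> T \<longrightarrow> chi_pcf T = 2) \<and> (\<not> K\<^bsub>2\<^esub> T \<longrightarrow> chi_pcf T = 3)"
proof (intro conjI impI)
  interpret graph T using assms unfolding undirected_tree_def by blast
  have conn: "connected T" using assms unfolding undirected_tree_def by blast
  show "chi_pcf T = 2" if "K\<^bsub>2\<^esub> T"
    unfolding chi_pcf_def
  proof (rule Least_equality)
    \<comment> \<open>K_2 has two vertices, so an injective coloring stays within two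
      colors.\<close>
    show "\<exists>c. pcf_coloring T 2 c"
      using pcf_coloring_exists[of T] that unfolding complete_digraph_def by auto
    show "2 \<le> k" if "\<exists>c. pcf_coloring T k c" for k
      using that connected_exists_edge[OF conn assms(2)] pcf_coloring_edge_ge_2 by metis
  qed
  show "chi_pcf T = 3" if "\<not> K\<^bsub>2\<^esub> T"
    unfolding chi_pcf_def
  proof (rule Least_equality)
    show "\<exists>c. pcf_coloring T 3 c"
      using undirected_tree_pcf_3_coloring assms by fastforce
    show "3 \<le> k" if "\<exists>c. pcf_coloring T k c" for k
      using that connected_exists_two_neighbors[OF conn assms(2) \<open>\<not> K\<^bsub>2\<^esub> T\<close>]
        pcf_coloring_two_neighbors_ge_3 by metis
  qed
qed

end
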